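(* Let $\mathcal{H}$ be a complex Hilbert space, let $T$ be an $EP$ operator on $\mathcal{H}$ and let $A\in\mathcal{B}(\mathcal{H})$. If $AT=TA$ and $AT^*T=T^*TA$, then $AT^*=T^*A$.
   Context: $\mathcal{B}(\mathcal{H})$ is the space of bounded linear operators on $\mathcal{H}$; $\mathcal{R}(T)$ denotes the range of $T$ and $T^*$ its adjoint. An $EP$ operator on $\mathcal{H}$ is a $T\in\mathcal{B}(\mathcal{H})$ with closed range such that $\mathcal{R}(T)=\mathcal{R}(T^* )$. *)

theory Defs
  imports "HOL-Analysis.Analysis"
begin

class complex_vector = real_vector +
  fixes scaleC :: "complex \<Rightarrow> 'a \<Rightarrow> 'a" (infixr "*\<^sub>C" 75)
  assumes scaleC_add_right: "c *\<^sub>C (x + y) = c *\<^sub>C x + c *\<^sub>C y"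
    and scaleC_add_left: "(c + d) *\<^sub>C x = c *\<^sub>C x + d *\<^sub>C x"
    and scaleC_scaleC: "c *\<^sub>C d *\<^sub>C x = (c * d) *\<^sub>C x"
    and scaleC_one: "1 *\<^sub>C x = x"
    and scaleR_scaleC: "r *\<^sub>R x = complex_of_real r *\<^sub>C x"

text \<open>Inner products are linear in the first argument and conjugate-linear in the second.
  Extending \<^class>\<open>real_normed_vector\<close> only names the norm, metric and topology:
  \<open>norm_eq_sqrt_cinner\<close> forces the norm to be the one induced by the inner product.\<close>

class complex_inner = complex_vector + real_normed_vector +
  fixes cinner :: "'a \<Rightarrow> 'a \<Rightarrow> complex"
  assumes cinner_commute: "cinner x y = cnj (cinner y x)"
    and cinner_add_left: "cinner (x + y) z = cinner x z + cinner y z"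
    and cinner_scaleC_left: "cinner (c *\<^sub>C x) y = c * cinner x y"
    and cinner_ge_zero: "0 \<le> Re (cinner x x)"
    and cinner_eq_zero_iff: "cinner x x = 0 \<longleftrightarrow> x = 0"
    and norm_eq_sqrt_cinner: "norm x = sqrt (Re (cinner x x))"

class complex_hilbert_space = complex_inner + complete_space

definition bounded_clinear ::
    "('a::complex_inner \<Rightarrow> 'b::complex_inner) \<Rightarrow> bool" where
  "bounded_clinear T \<longleftrightarrow> bounded_linear T \<and> (\<forall>c x. T (c *\<^sub>C x) = c *\<^sub>C T x)"

text \<open>For a bounded operator between Hilbert spaces the described operator exists uniquely,
  by the Riesz representation theorem; otherwise the value is unspecified.\<close>

definition cadjoint ::
    "('a::complex_hilbert_space \<Rightarrow> 'b::complex_hilbert_space) \<Rightarrow> 'b \<Rightarrow> 'a" where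
  "cadjoint T = (THE S. bounded_clinear S \<and> (\<forall>x y. cinner (T x) y = cinner x (S y)))"

definition EP_operator :: "('a::complex_hilbert_space \<Rightarrow> 'a) \<Rightarrow> bool" where
  "EP_operator T \<longleftrightarrow>
    bounded_clinear T \<and> closed (range T) \<and> range T = range (cadjoint T)"

end

theory Submission
  imports Defs
begin

text \<open>
  Since \<open>T\<close> has closed range, the space splits orthogonally into the range of \<open>T\<close> and its
  orthogonal complement, which is the kernel of \<open>T\<^sup>*\<close>. Two linear maps that agree on both summands
  are equal, so \<open>A T\<^sup>* = T\<^sup>* A\<close> may be checked on each of them.

  On a vector \<open>T x\<close> the two hypotheses give \<open>A T\<^sup>* T x = T\<^sup>* T A x = T\<^sup>* A T x\<close>. For the
  other summand, taking orthogonal complements in the EP condition \<open>R(T) = R(T\<^sup>*)\<close> gives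
  \<open>ker T\<^sup>* = ker T\<close>, and \<open>ker T\<close> is invariant under \<open>A\<close> because \<open>A\<close> commutes with \<open>T\<close>. Hence both
  \<open>A T\<^sup>*\<close> and \<open>T\<^sup>* A\<close> vanish there.

  Both analytic ingredients, the existence of the adjoint and the orthogonal decomposition, are cases
  of one Riesz theorem for a functional restricted to a closed subspace
  (\<open>riesz_on_closed_subspace\<close>). The adjoint represents \<open>x \<mapsto> \<langle>T x, y\<rangle>\<close> on the whole space; the
  orthogonal projection of \<open>v\<close> onto \<open>M\<close> represents \<open>x \<mapsto> \<langle>x, v\<rangle>\<close> on \<open>M\<close>.
\<close>

section \<open>Complex inner products\<close>

lemma cinner_add_right: "cinner x (y + z) = cinner x y + cinner x (z::'a::complex_inner)"
  by (metis cinner_add_left cinner_commute complex_cnj_add)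

lemma cinner_scaleC_right: "cinner x (c *\<^sub>C y) = cnj c * cinner x (y::'a::complex_inner)"
  by (metis cinner_commute cinner_scaleC_left complex_cnj_mult)

lemma cinner_scaleR_left: "cinner (r *\<^sub>R x) y = of_real r * cinner x (y::'a::complex_inner)"
  by (simp add: scaleR_scaleC cinner_scaleC_left)

lemma cinner_scaleR_right: "cinner x (r *\<^sub>R y) = of_real r * cinner x (y::'a::complex_inner)"
  by (simp add: scaleR_scaleC cinner_scaleC_right)

lemma cinner_minus_left: "cinner (- x) y = - cinner x (y::'a::complex_inner)"
  using cinner_scaleR_left[of "-1" x y] by simp

lemma cinner_diff_left: "cinner (x - y) z = cinner x z - cinner y (z::'a::complex_inner)"
  using cinner_add_left[of x "- y" z] by (simp add: cinner_minus_left)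

lemma cinner_diff_right: "cinner x (y - z) = cinner x y - cinner x (z::'a::complex_inner)"
  by (metis cinner_commute cinner_diff_left complex_cnj_diff)

lemma cinner_zero_left: "cinner 0 y = (0::complex)" for y :: "'a::complex_inner"
  using cinner_diff_left[of y y y] by simp

lemma cinner_zero_right: "cinner x 0 = (0::complex)" for x :: "'a::complex_inner"
  using cinner_diff_right[of x x x] by simp

lemma power2_norm_eq_cinner: "(norm x)\<^sup>2 = Re (cinner x x)" for x :: "'a::complex_inner"
  by (simp add: norm_eq_sqrt_cinner cinner_ge_zero)

lemma Re_cinner_commute: "Re (cinner x y) = Re (cinner y x)" for x :: "'a::complex_inner"
  by (subst cinner_commute) simp

lemma power2_norm_add:
  "(norm (x + y))\<^sup>2 = (norm x)\<^sup>2 + 2 * Re (cinner x y) + (norm y)\<^sup>2" for x :: "'a::complex_inner"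
  using Re_cinner_commute[of x y]
  by (simp add: power2_norm_eq_cinner cinner_add_left cinner_add_right)

text \<open>The triangle inequality is part of the structure of a normed space, so the Cauchy-Schwarz
  inequality follows from it by expanding the square of the norm of a sum.\<close>

lemma Re_cinner_le: "Re (cinner x y) \<le> norm x * norm y" for x :: "'a::complex_inner"
proof -
  have "(norm (x + y))\<^sup>2 \<le> (norm x + norm y)\<^sup>2"
    by (intro power_mono norm_triangle_ineq norm_ge_zero)
  then show ?thesis
    by (simp add: power2_norm_add power2_sum)
qed

lemma abs_Re_cinner_le: "\<bar>Re (cinner x y)\<bar> \<le> norm x * norm y" for x :: "'a::complex_inner"
  using Re_cinner_le[of x y] Re_cinner_le[of "- x" y] by (auto simp: cinner_minus_left abs_le_iff)

lemma bounded_linear_Re_cinner: "bounded_linear (\<lambda>x. Re (cinner x y))" for y :: "'a::complex_inner"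
  by (rule bounded_linear_intro[where K = "norm y"])
    (auto simp: cinner_add_left cinner_scaleR_left abs_Re_cinner_le)

lemma cinner_eqI:
  assumes "\<And>x. cinner x u = cinner x v"
  shows "u = (v::'a::complex_inner)"
proof -
  have "cinner (u - v) (u - v) = 0"
    by (simp add: cinner_diff_right assms)
  then show ?thesis
    by (simp add: cinner_eq_zero_iff)
qed

section \<open>Riesz representation on a closed subspace\<close>

text \<open>The representing vector is the minimiser of \<open>F x = \<parallel>x\<parallel>\<^sup>2 - 2 f x\<close> on \<open>M\<close>. Boundedness of \<open>f\<close>
  bounds \<open>F\<close> below, and the parallelogram law
  \<open>\<parallel>x - y\<parallel>\<^sup>2 = 2 (F x + F y) - 4 F ((x + y) / 2)\<close> forces every minimising sequence to be Cauchy.\<close>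

lemma quadratic_minimiser_on_closed_subspace:
  fixes M :: "'a::complex_hilbert_space set" and f :: "'a \<Rightarrow> real"
  assumes M: "closed M" "subspace M" and f: "bounded_linear f"
  shows "\<exists>u\<in>M. \<forall>x\<in>M. (norm u)\<^sup>2 - 2 * f u \<le> (norm x)\<^sup>2 - 2 * f x"
proof -
  interpret f: bounded_linear f by (rule f)
  define F where "F x = (norm x)\<^sup>2 - 2 * f x" for x
  obtain K where K: "\<And>x. norm (f x) \<le> norm x * K"
    using f.bounded by blast
  have "- K\<^sup>2 \<le> F x" for x
  proof -
    have "0 \<le> (norm x - K)\<^sup>2" by simp
    then show ?thesis
      using K[of x] unfolding F_def by (simp add: power2_diff)
  qed
  then have bdd: "bdd_below (F ` M)" by (meson bdd_belowI2)
  have ne: "F ` M \<noteq> {}" using subspace_0[OF M(2)] by blast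
  define m where "m = Inf (F ` M)"
  have m_le: "m \<le> F x" if "x \<in> M" for x
    unfolding m_def using bdd that by (simp add: cINF_lower)
  have "\<exists>x\<in>M. F x < m + inverse (Suc n)" for n
  proof -
    have "Inf (F ` M) < m + inverse (Suc n)" by (simp add: m_def)
    then show ?thesis using cInf_less_iff[OF ne bdd] by blast
  qed
  then obtain X where X: "\<And>n. X n \<in> M" "\<And>n. F (X n) < m + inverse (Suc n)"
    by metis
  have parallelogram: "(norm (x - y))\<^sup>2 = 2 * (F x + F y) - 4 * F ((1/2) *\<^sub>R (x + y))" for x y
    using Re_cinner_commute[of x y] unfolding F_def
    by (simp add: f.scaleR f.add power_divide power2_norm_eq_cinner cinner_add_left
        cinner_add_right cinner_diff_left cinner_diff_right cinner_scaleR_left cinner_scaleR_right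
        field_simps)
  have close: "(norm (X i - X j))\<^sup>2 \<le> 2 * (inverse (Suc i) + inverse (Suc j))" for i j
  proof -
    have "m \<le> F ((1/2) *\<^sub>R (X i + X j))"
      by (intro m_le subspace_scale subspace_add M(2) X)
    then show ?thesis
      using parallelogram[of "X i" "X j"] X(2)[of i] X(2)[of j] by argo
  qed
  have "Cauchy X"
  proof (rule metric_CauchyI)
    fix e :: real assume "e > 0"
    then have "e\<^sup>2 / 4 > 0" by simp
    then obtain N where N: "inverse (Suc N) < e\<^sup>2 / 4"
      using reals_Archimedean by blast
    have "dist (X i) (X j) < e" if "i \<ge> N" "j \<ge> N" for i j
    proof -
      have "inverse (Suc i) \<le> inverse (real (Suc N))" "inverse (Suc j) \<le> inverse (real (Suc N))"
        using that by (auto intro: le_imp_inverse_le)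
      then have "(norm (X i - X j))\<^sup>2 < e\<^sup>2"
        using close[of i j] N by argo
      then show ?thesis
        using \<open>e > 0\<close> by (simp add: dist_norm power2_less_imp_less)
    qed
    then show "\<exists>N. \<forall>i\<ge>N. \<forall>j\<ge>N. dist (X i) (X j) < e" by blast
  qed
  then obtain u where u: "X \<longlonglongrightarrow> u"
    using Cauchy_convergent_iff convergent_def by blast
  have "u \<in> M" using M(1) X(1) u closed_sequentially by blast
  have "(\<lambda>n. F (X n)) \<longlonglongrightarrow> F u"
    unfolding F_def by (intro tendsto_intros f.tendsto u)
  moreover have "(\<lambda>n. m + inverse (Suc n)) \<longlonglongrightarrow> m + 0"
    by (intro tendsto_intros LIMSEQ_inverse_real_of_nat)
  ultimately have "F u \<le> m + 0"
    by (rule LIMSEQ_le) (use X(2) less_imp_le in blast)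
  then have "\<forall>x\<in>M. F u \<le> F x" using m_le by force
  with \<open>u \<in> M\<close> show ?thesis unfolding F_def by blast
qed

text \<open>The first variation of the functional vanishes at its minimiser: along the line \<open>u + t x\<close> it
  grows by \<open>t\<^sup>2 \<parallel>x\<parallel>\<^sup>2 + 2 t (Re \<langle>x, u\<rangle> - f x)\<close>, which is nonnegative for all real \<open>t\<close> only if the
  linear coefficient is zero.\<close>

lemma real_riesz_on_closed_subspace:
  fixes M :: "'a::complex_hilbert_space set" and f :: "'a \<Rightarrow> real"
  assumes M: "closed M" "subspace M" and f: "bounded_linear f"
  shows "\<exists>u\<in>M. \<forall>x\<in>M. f x = Re (cinner x u)"
proof -
  interpret f: bounded_linear f by (rule f)
  obtain u where u: "u \<in> M" "\<And>x. x \<in> M \<Longrightarrow> (norm u)\<^sup>2 - 2 * f u \<le> (norm x)\<^sup>2 - 2 * f x"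
    using quadratic_minimiser_on_closed_subspace[OF assms] by blast
  have "f x = Re (cinner x u)" if "x \<in> M" for x
  proof -
    define b where "b = Re (cinner x u) - f x"
    have var: "0 \<le> t\<^sup>2 * (norm x)\<^sup>2 + 2 * t * b" for t
    proof -
      have "u + t *\<^sub>R x \<in> M"
        by (intro subspace_add subspace_scale M(2) u(1) that)
      from u(2)[OF this] show ?thesis
        using Re_cinner_commute[of x u]
        by (simp add: power2_norm_add f.add f.scaleR cinner_scaleR_right power_mult_distrib b_def
            algebra_simps)
    qed
    have "b = 0"
    proof (rule ccontr)
      assume "b \<noteq> 0"
      \<comment> \<open>The quadratic in \<open>t\<close> is least at \<open>- b / \<parallel>x\<parallel>\<^sup>2\<close>; adding \<open>1\<close> to the denominator keeps
        the value negative and covers \<open>x = 0\<close>.\<close>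
      define s where "s = (norm x)\<^sup>2 + 1"
      have s: "s > 0" "(norm x)\<^sup>2 = s - 1" by (simp_all add: s_def add_nonneg_pos)
      have "(- b / s)\<^sup>2 * (norm x)\<^sup>2 + 2 * (- b / s) * b = - (b\<^sup>2 * (s + 1)) / s\<^sup>2"
        unfolding s(2) using s(1) by (simp add: field_simps power2_eq_square)
      also have "\<dots> < 0"
        using s \<open>b \<noteq> 0\<close> by (simp add: divide_neg_pos)
      finally show False using var[of "- b / s"] by linarith
    qed
    then show ?thesis by (simp add: b_def)
  qed
  with u(1) show ?thesis by blast
qed

text \<open>A complex linear functional is determined by its real part, since \<open>Im (g x) = - Re (g (\<i> x))\<close>.\<close>

lemma riesz_on_closed_subspace:
  fixes M :: "'a::complex_hilbert_space set" and g :: "'a \<Rightarrow> complex"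
  assumes M: "closed M" "subspace M" and MC: "\<And>c x. x \<in> M \<Longrightarrow> c *\<^sub>C x \<in> M"
    and g: "bounded_linear (\<lambda>x. Re (g x))" and gC: "\<And>c x. g (c *\<^sub>C x) = c * g x"
  shows "\<exists>u\<in>M. \<forall>x\<in>M. g x = cinner x u"
proof -
  obtain u where u: "u \<in> M" "\<And>x. x \<in> M \<Longrightarrow> Re (g x) = Re (cinner x u)"
    using real_riesz_on_closed_subspace[OF M g] by blast
  have "g x = cinner x u" if "x \<in> M" for x
  proof (rule complex_eqI)
    show "Re (g x) = Re (cinner x u)" using u(2) that .
    show "Im (g x) = Im (cinner x u)"
      using u(2)[OF MC[OF that, of \<i>]] by (simp add: gC cinner_scaleC_left)
  qed
  with u(1) show ?thesis by blast
qed

lemma orthogonal_decomposition: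
  fixes M :: "'a::complex_hilbert_space set"
  assumes "closed M" "subspace M" "\<And>c x. x \<in> M \<Longrightarrow> c *\<^sub>C x \<in> M"
  obtains u w where "v = u + w" "u \<in> M" "\<And>x. x \<in> M \<Longrightarrow> cinner x w = 0"
proof -
  obtain u where u: "u \<in> M" "\<And>x. x \<in> M \<Longrightarrow> cinner x v = cinner x u"
    using riesz_on_closed_subspace[OF assms, where g = "\<lambda>x. cinner x v"]
      bounded_linear_Re_cinner cinner_scaleC_left by blast
  show ?thesis
    by (rule that[of u "v - u"]) (use u in \<open>auto simp: cinner_diff_right\<close>)
qed

section \<open>Adjoints and kernels\<close>

lemma ex1_adjoint:
  fixes T :: "'a::complex_hilbert_space \<Rightarrow> 'b::complex_hilbert_space"
  assumes T: "bounded_clinear T"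
  shows "\<exists>!S. bounded_clinear S \<and> (\<forall>x y. cinner (T x) y = cinner x (S y))"
proof -
  have bT: "bounded_linear T" and TC: "\<And>c x. T (c *\<^sub>C x) = c *\<^sub>C T x"
    using T by (auto simp: bounded_clinear_def)
  have "\<exists>u. \<forall>x. cinner (T x) y = cinner x u" for y
    using riesz_on_closed_subspace[where M = UNIV and g = "\<lambda>x. cinner (T x) y"]
      bounded_linear_compose[OF bounded_linear_Re_cinner bT]
    by (auto simp: TC cinner_scaleC_left)
  then obtain S where S: "\<And>x y. cinner (T x) y = cinner x (S y)"
    by metis
  have add: "S (y + z) = S y + S z" for y z
    by (rule cinner_eqI) (simp add: cinner_add_right flip: S)
  have scale: "S (c *\<^sub>C y) = c *\<^sub>C S y" for c y
    by (rule cinner_eqI) (simp add: cinner_scaleC_right flip: S)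
  obtain K where K: "\<And>x. norm (T x) \<le> norm x * K" "K \<ge> 0"
    using bounded_linear.nonneg_bounded[OF bT] by blast
  have "norm (S y) \<le> norm y * K" for y
  proof (cases "S y = 0")
    case False
    have "norm (S y) * norm (S y) = Re (cinner (T (S y)) y)"
      by (simp add: S power2_norm_eq_cinner flip: power2_eq_square)
    also have "\<dots> \<le> norm (T (S y)) * norm y" by (rule Re_cinner_le)
    also have "\<dots> \<le> (norm (S y) * K) * norm y" by (intro mult_right_mono K) simp
    finally have "norm (S y) * norm (S y) \<le> norm (S y) * (norm y * K)" by (simp add: ac_simps)
    then show ?thesis using False by simp
  qed (use K in simp)
  then have "bounded_clinear S"
    unfolding bounded_clinear_def
    by (auto intro!: bounded_linear_intro simp: add scale scaleR_scaleC)
  moreover have "S' = S" if "\<forall>x y. cinner (T x) y = cinner x (S' y)" for S'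
    using that by (intro ext cinner_eqI) (simp flip: S)
  ultimately show ?thesis using S by (intro ex1I[of _ S]) auto
qed

lemma
  assumes "bounded_clinear T"
  shows bounded_clinear_cadjoint: "bounded_clinear (cadjoint T)"
    and cinner_cadjoint: "cinner (T x) y = cinner x (cadjoint T y)"
  using theI'[OF ex1_adjoint[OF assms]] unfolding cadjoint_def by blast+

lemma cadjoint_eq_0_iff:
  assumes "bounded_clinear T"
  shows "cadjoint T w = 0 \<longleftrightarrow> (\<forall>x\<in>range T. cinner x w = 0)"
  by (auto simp: cinner_cadjoint[OF assms] cinner_zero_right intro: cinner_eqI)

lemma eq_0_iff_orthogonal_range_cadjoint:
  assumes "bounded_clinear T"
  shows "T w = 0 \<longleftrightarrow> (\<forall>x\<in>range (cadjoint T). cinner x w = 0)"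
proof
  assume "T w = 0"
  then have "cinner w (cadjoint T y) = 0" for y
    by (simp add: cinner_zero_left flip: cinner_cadjoint[OF assms])
  then show "\<forall>x\<in>range (cadjoint T). cinner x w = 0"
    by (metis cinner_commute complex_cnj_zero imageE)
next
  assume *: "\<forall>x\<in>range (cadjoint T). cinner x w = 0"
  then have "cinner (T w) (T w) = 0"
    by (metis cinner_cadjoint[OF assms] cinner_commute complex_cnj_zero rangeI)
  then show "T w = 0" by (simp add: cinner_eq_zero_iff)
qed

lemma EP_operator_cadjoint_eq_0_iff:
  assumes "EP_operator T"
  shows "cadjoint T w = 0 \<longleftrightarrow> T w = 0"
proof -
  have "bounded_clinear T" "range T = range (cadjoint T)"
    using assms by (auto simp: EP_operator_def)
  then show ?thesis
    using cadjoint_eq_0_iff eq_0_iff_orthogonal_range_cadjoint by metis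
qed

lemma EP_operator_decomposition:
  fixes T :: "'a::complex_hilbert_space \<Rightarrow> 'a"
  assumes "EP_operator T"
  obtains x w where "v = T x + w" "T w = 0"
proof -
  have T: "bounded_clinear T" and clo: "closed (range T)"
    using assms by (auto simp: EP_operator_def)
  then have "linear T" and TC: "\<And>c x. T (c *\<^sub>C x) = c *\<^sub>C T x"
    by (auto simp: bounded_clinear_def bounded_linear.linear)
  then have sub: "subspace (range T)"
    using linear_subspace_image subspace_UNIV by blast
  have cscale: "c *\<^sub>C y \<in> range T" if "y \<in> range T" for c y
    using that by (auto simp flip: TC)
  obtain u w where "v = u + w" "u \<in> range T" "\<And>x. x \<in> range T \<Longrightarrow> cinner x w = 0"
    using orthogonal_decomposition[OF clo sub cscale] by metis
  then show ?thesis
    using that cadjoint_eq_0_iff[OF T] EP_operator_cadjoint_eq_0_iff[OF assms] by blast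
qed

section \<open>Commutation with the adjoint\<close>

theorem theorem3p5:
  fixes T A :: "'a::complex_hilbert_space \<Rightarrow> 'a"
  assumes "EP_operator T"
    and "bounded_clinear A"
    and "A \<circ> T = T \<circ> A"
    and "A \<circ> (cadjoint T \<circ> T) = (cadjoint T \<circ> T) \<circ> A"
  shows "A \<circ> cadjoint T = cadjoint T \<circ> A"
proof
  fix v
  have T: "bounded_clinear T" using assms(1) by (simp add: EP_operator_def)
  interpret A: bounded_linear A using assms(2) by (simp add: bounded_clinear_def)
  interpret S: bounded_linear "cadjoint T"
    using bounded_clinear_cadjoint[OF T] by (simp add: bounded_clinear_def)
  interpret T: bounded_linear T using T by (simp add: bounded_clinear_def)
  have AT: "A (T x) = T (A x)" and AST: "A (cadjoint T (T x)) = cadjoint T (T (A x))" for x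
    using assms(3,4) by (auto simp: fun_eq_iff)
  obtain x w where v: "v = T x + w" and w: "T w = 0"
    using EP_operator_decomposition[OF assms(1)] .
  have "T (A w) = 0" using AT[of w] w by (simp add: A.zero)
  then have "cadjoint T w = 0" "cadjoint T (A w) = 0"
    using w EP_operator_cadjoint_eq_0_iff[OF assms(1)] by auto
  then show "(A \<circ> cadjoint T) v = (cadjoint T \<circ> A) v"
    by (simp add: v S.add A.add A.zero AT AST)
qed

end
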